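(* Let $G=([n],E)$ be a natural unit interval graph, and let $R$ be a region of the graphical arrangement $\mathcal{A}_G$. Let $\sigma\in\mathfrak{S}_n$ be the lexicographically minimum permutation of $S_R$. Let $v=(v_1,\ldots,v_n)\in\mathbb{R}^n$ be such that $v_i>(6n^2+1)v_{i+1}$ for all $i\in\{1,\ldots,n-1\}$ and $v_n>0$. Then $\mathrm{pd}_v(R)=\mathrm{RLmin}(\sigma)$.
   Context: $[n]=\{1,\ldots,n\}$; graphs are finite, undirected, without loops or multiple edges. $G=([n],E)$ is a natural unit interval graph if for all $\{i,j\}\in E$ with $i<j$, one has $\{i,k\}\in E$ and $\{k,j\}\in E$ for all $i<k<j$. The graphical arrangement $\mathcal{A}_G$ is the collection of hyperplanes $\{x\in\mathbb{R}^n:x_i=x_j\}$ for $\{i,j\}\in E$. Regions are taken closed (closures of connected components of the complement of the hyperplanes). For $\sigma=\sigma_1\cdots\sigma_n\in\mathfrak{S}_n$ (one-line notation), let $R_\sigma=\{x\in\mathbb{R}^n: x_{\sigma_1}\ge\cdots\ge x_{\sigma_n}\}$. Each region $R$ of $\mathcal{A}_G$ is a union of sets $R_\sigma$, and $S_R=\{\sigma\in\mathfrak{S}_n: R_\sigma\subseteq R\}$. Permutations are compared lexicographically in one-line notation. $\mathrm{proj}_v(R)$ is the unique point of $R$ at minimum Euclidean distance from $v$, and $\mathrm{pd}_v(R)$ is the dimension of the unique face of $R$ containing $\mathrm{proj}_v(R)$ in its relative interior. An entry $\sigma_i$ is a right-to-left minimum of $\sigma$ if $\sigma_i<\sigma_j$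 for all $j>i$; $\mathrm{RLmin}(\sigma)$ is the number of right-to-left minima of $\sigma$. *)

theory Defs
  imports "HOL-Analysis.Analysis" "HOL-Library.Fun_Lexorder"
begin

text \<open>
  The index set $[n]$ is modelled by a type \<open>'n\<close> that is finite and linearly ordered, with
  $n = $ \<open>CARD('n)\<close>; such a type has a unique order isomorphism with $\{1,\ldots,n\}$.
  A graph on the vertex set $[n]$ is given by its set of edges, which are two-element sets of
  vertices.  A permutation $\sigma$ of $[n]$ is a bijection of \<open>'n\<close>, and the entry
  $\sigma_i$ of its one-line notation is \<open>\<sigma> i\<close>.
\<close>

definition simple_graph :: "'n set set \<Rightarrow> bool" where
  "simple_graph E \<longleftrightarrow> (\<forall>e\<in>E. card e = 2)"

definition natural_unit_interval_graph :: "'n::linorder set set \<Rightarrow> bool" where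
  "natural_unit_interval_graph E \<longleftrightarrow> simple_graph E \<and>
     (\<forall>i j. i < j \<longrightarrow> {i, j} \<in> E \<longrightarrow>
        (\<forall>k. i < k \<longrightarrow> k < j \<longrightarrow> {i, k} \<in> E \<and> {k, j} \<in> E))"

definition graphical_arrangement :: "'n set set \<Rightarrow> (real^'n) set set" where
  "graphical_arrangement E = {{x. x $ i = x $ j} | i j. {i, j} \<in> E}"

definition regions :: "'a::topological_space set set \<Rightarrow> 'a set set" where
  "regions A = closure ` components (- \<Union>A)"

definition perm_cone :: "('n \<Rightarrow> 'n) \<Rightarrow> (real^'n::{finite,linorder}) set" where
  "perm_cone \<sigma> = {x. \<forall>i j. i \<le> j \<longrightarrow> x $ \<sigma> i \<ge> x $ \<sigma> j}"

definition region_perms :: "(real^'n::{finite,linorder}) set \<Rightarrow> ('n \<Rightarrow> 'n) set" where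
  "region_perms R = {\<sigma>. bij \<sigma> \<and> perm_cone \<sigma> \<subseteq> R}"

text \<open>
  \<open>less_fun\<close> is the strict lexicographic order on functions; on permutations it
  compares one-line notations.
\<close>

definition is_lex_min :: "('n::linorder \<Rightarrow> 'n) \<Rightarrow> ('n \<Rightarrow> 'n) set \<Rightarrow> bool" where
  "is_lex_min \<sigma> S \<longleftrightarrow> \<sigma> \<in> S \<and> (\<forall>\<tau>\<in>S. \<tau> = \<sigma> \<or> less_fun \<sigma> \<tau>)"

text \<open>
  The definite description is meaningful for nonempty polyhedra: there the minimising point is
  unique, and the relative interiors of the nonempty faces partition the polyhedron.
\<close>

definition proj_dim :: "'a::euclidean_space \<Rightarrow> 'a set \<Rightarrow> int" where
  "proj_dim v R = aff_dim (THE F. F face_of R \<and> closest_point R v \<in> rel_interior F)"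

definition RLmin :: "('n::linorder \<Rightarrow> 'n) \<Rightarrow> nat" where
  "RLmin \<sigma> = card {i. \<forall>j. i < j \<longrightarrow> \<sigma> i < \<sigma> j}"

end

theory Submission
  imports Defs
begin

text \<open>
  Cut the one-line notation of \<open>\<sigma>\<close> after each right-to-left minimum. Each entry \<open>a\<close> lies in a
  block whose last entry is also its least entry \<open>m\<close>. If \<open>\<sigma>\<close> is lexicographically minimal,
  then \<open>y\<^sub>a \<ge> y\<^sub>m\<close> on all of \<open>R\<close>: a descent between consecutive entries must be an edge, since
  otherwise exchanging them would give a smaller permutation in the region, and at an ascent the path
  from the next entry down to \<open>m\<close> jumps over \<open>a\<close>, so the interval property yields an edge from \<open>a\<close>
  into this path. As \<open>v\<^sub>m\<close> dominates the other \<open>v\<^sub>a\<close> of its block, replacing \<open>v\<close> by its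
  block averages gives the projection of \<open>v\<close>. The averages strictly decrease from block to block, so
  the face in question consists of the points of \<open>R\<close> that are constant on blocks.
\<close>

text \<open>For a simple graph and a bijection \<open>\<sigma>\<close>, this is the component of the
  complement of the arrangement that contains the interior of
  \<open>perm_cone \<sigma>\<close>.\<close>

definition open_chamber :: "'n set set \<Rightarrow> ('n \<Rightarrow> 'n) \<Rightarrow> (real^'n::{finite,linorder}) set" where
  "open_chamber E \<sigma> = {y. \<forall>i j. i < j \<longrightarrow> {\<sigma> i, \<sigma> j} \<in> E \<longrightarrow> y $ \<sigma> j < y $ \<sigma> i}"

definition closed_chamber :: "'n set set \<Rightarrow> ('n \<Rightarrow> 'n) \<Rightarrow> (real^'n::{finite,linorder}) set" where
  "closed_chamber E \<sigma> = {y. \<forall>i j. i < j \<longrightarrow> {\<sigma> i, \<sigma> j} \<in> E \<longrightarrow> y $ \<sigma> j \<le> y $ \<sigma> i}"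

text \<open>For a bijection, the value is the right-to-left minimum that closes the block of
  \<open>a\<close>, so the fibres are the blocks. Naming a block by an entry makes this an
  idempotent map on coordinates.\<close>

definition block_min :: "('n \<Rightarrow> 'n) \<Rightarrow> 'n \<Rightarrow> 'n::{finite,linorder}" where
  "block_min \<sigma> a = Min (\<sigma> ` {inv \<sigma> a..})"

text \<open>The orthogonal projection of \<open>v\<close> onto the vectors that are constant on the
  fibres of \<open>f\<close>.\<close>

definition fiber_average :: "('n \<Rightarrow> 'b) \<Rightarrow> real^'n \<Rightarrow> real^'n::finite" where
  "fiber_average f v = (\<chi> a. (\<Sum>b | f b = f a. v $ b) / card {b. f b = f a})"

section \<open>Chambers\<close>

lemma open_chamber_eq:
  "open_chamber E \<sigma> =
    (\<Inter>(i, j)\<in>{(i, j). i < j \<and> {\<sigma> i, \<sigma> j} \<in> E}. {y. y $ \<sigma> j < y $ \<sigma> i})"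
  by (auto simp: open_chamber_def)

lemma closed_chamber_eq:
  "closed_chamber E \<sigma> =
    (\<Inter>(i, j)\<in>{(i, j). i < j \<and> {\<sigma> i, \<sigma> j} \<in> E}. {y. y $ \<sigma> j \<le> y $ \<sigma> i})"
  by (auto simp: closed_chamber_def)

lemma open_open_chamber: "open (open_chamber E \<sigma>)"
  unfolding open_chamber_eq
  by (intro open_INT) (auto intro!: open_Collect_less continuous_intros)

lemma closed_closed_chamber: "closed (closed_chamber E \<sigma>)"
  unfolding closed_chamber_eq
  by (intro closed_INT) (auto intro!: closed_Collect_le continuous_intros)

lemma convex_Collect_nth_le:
  "convex {y :: real^'n::finite. y $ b \<le> y $ a}" (is ?le)
  and convex_Collect_nth_less:
  "convex {y :: real^'n::finite. y $ b < y $ a}" (is ?less)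
proof -
  have lin: "linear (\<lambda>y :: real^'n. y $ a - y $ b)"
    by (intro linearI) (simp_all add: algebra_simps)
  have "convex ((\<lambda>y :: real^'n. y $ a - y $ b) -` {0..})"
    "convex ((\<lambda>y :: real^'n. y $ a - y $ b) -` {0<..})"
    using convex_linear_vimage[OF lin] by auto
  then show ?le ?less by (simp_all add: vimage_def)
qed

lemma convex_open_chamber: "convex (open_chamber E \<sigma>)"
  unfolding open_chamber_eq
  by (intro convex_INT) (auto intro: convex_Collect_nth_less)

lemma convex_closed_chamber: "convex (closed_chamber E \<sigma>)"
  unfolding closed_chamber_eq
  by (intro convex_INT) (auto intro: convex_Collect_nth_le)

text \<open>Each coordinate counts the positions from its entry on. Such a point serves below as a
  base point inside the cone and as a direction that turns all weak inequalities strict at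
  once.\<close>

lemma ex_strictly_decreasing:
  fixes \<sigma> :: "'n::{finite,linorder} \<Rightarrow> 'n"
  assumes "bij \<sigma>"
  obtains p :: "real^'n::{finite,linorder}" where "\<And>i j. i < j \<Longrightarrow> p $ \<sigma> j < p $ \<sigma> i"
proof
  let ?p = "(\<chi> a. real (card {inv \<sigma> a..})) :: real^'n::{finite,linorder}"
  fix i j :: 'n assume "i < j"
  then have "{j..} \<subset> {i..}" by (auto simp: psubset_eq)
  then have "card {j..} < card {i..}" by (intro psubset_card_mono) auto
  then show "?p $ \<sigma> j < ?p $ \<sigma> i"
    using assms by (simp add: bij_is_inj)
qed

lemma closure_open_chamber:
  fixes E :: "'n::{finite,linorder} set set"
  assumes "bij \<sigma>"
  shows "closure (open_chamber E \<sigma>) = closed_chamber E \<sigma>"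
proof
  show "closure (open_chamber E \<sigma>) \<subseteq> closed_chamber E \<sigma>"
    by (intro closure_minimal closed_closed_chamber)
      (auto simp: open_chamber_def closed_chamber_def less_imp_le)
  obtain p :: "real^'n::{finite,linorder}" where p: "\<And>i j. i < j \<Longrightarrow> p $ \<sigma> j < p $ \<sigma> i"
    using ex_strictly_decreasing[OF assms] by blast
  show "closed_chamber E \<sigma> \<subseteq> closure (open_chamber E \<sigma>)"
  proof
    fix y assume y: "y \<in> closed_chamber E \<sigma>"
    have "\<exists>z\<in>open_chamber E \<sigma>. dist z y < e" if "e > 0" for e
    proof -
      \<comment> \<open>The summand 1 keeps the denominator positive even if \<open>p = 0\<close>
        and makes the distance bound strict.\<close>
      define t where "t = e / (norm p + 1)"
      have pos: "norm p + 1 > 0"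
        using norm_ge_zero[of p] by linarith
      have t: "t > 0" unfolding t_def using that pos by simp
      have "dist (y + t *\<^sub>R p) y = t * norm p"
        using t by (simp add: dist_norm)
      also have "\<dots> < t * (norm p + 1)" using t by simp
      also have "\<dots> = e" unfolding t_def using pos by simp
      finally have "dist (y + t *\<^sub>R p) y < e" .
      moreover have "y + t *\<^sub>R p \<in> open_chamber E \<sigma>"
        using y p t by (auto simp: open_chamber_def closed_chamber_def intro!: add_le_less_mono)
      ultimately show ?thesis by blast
    qed
    then show "y \<in> closure (open_chamber E \<sigma>)"
      by (simp add: closure_approachable)
  qed
qed

text \<open>The cone contains a strictly decreasing point; the open chamber is a neighbourhood of it
  and so meets \<open>C\<close>. The chamber is convex and avoids all hyperplanes, hence lies in
  \<open>C\<close>; conversely, a coordinate difference along an edge has no zero on the connected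
  set \<open>C\<close> and keeps its sign.\<close>

lemma region_eq_closed_chamber:
  fixes E :: "'n::{finite,linorder} set set"
  assumes "simple_graph E" and "R \<in> regions (graphical_arrangement E)"
    and "bij \<sigma>" and "perm_cone \<sigma> \<subseteq> R"
  shows "R = closed_chamber E \<sigma>"
proof -
  let ?U = "- \<Union>(graphical_arrangement E)" and ?P = "open_chamber E \<sigma>"
  obtain C where C: "C \<in> components ?U" and R: "R = closure C"
    using assms(2) by (auto simp: regions_def)
  obtain p :: "real^'n::{finite,linorder}" where p: "\<And>i j. i < j \<Longrightarrow> p $ \<sigma> j < p $ \<sigma> i"
    using ex_strictly_decreasing[OF assms(3)] by blast
  have "p \<in> perm_cone \<sigma>"
    using p by (auto simp: perm_cone_def le_less)
  then have "p \<in> closure C" using assms(4) R by blast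
  moreover have "p \<in> ?P" using p by (auto simp: open_chamber_def)
  ultimately have "?P \<inter> C \<noteq> {}"
    using open_Int_closure_eq_empty[OF open_open_chamber] by blast
  then obtain q where q: "q \<in> ?P" "q \<in> C" by blast
  have "?P \<subseteq> ?U"
  proof
    fix y assume y: "y \<in> ?P"
    then have less: "y $ \<sigma> j < y $ \<sigma> i" if "i < j" "{\<sigma> i, \<sigma> j} \<in> E" for i j
      using that by (simp add: open_chamber_def)
    have False if "{a, b} \<in> E" "y $ a = y $ b" for a b
    proof -
      have "a \<noteq> b" using assms(1) that(1) by (auto simp: simple_graph_def)
      moreover obtain i j where ab: "a = \<sigma> i" "b = \<sigma> j"
        using surjD[OF bij_is_surj[OF assms(3)]] by blast
      ultimately consider "i < j" | "j < i" by fastforce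
      then show False
        using less[of i j] less[of j i] that ab by cases (simp_all add: insert_commute)
    qed
    then show "y \<in> ?U" by (auto simp: graphical_arrangement_def)
  qed
  then have "?P \<subseteq> C"
    using q by (intro components_maximal[OF C]) (auto intro: convex_connected convex_open_chamber)
  moreover have "C \<subseteq> ?P"
  proof
    fix y assume y: "y \<in> C"
    have "y $ \<sigma> j < y $ \<sigma> i" if "i < j" "{\<sigma> i, \<sigma> j} \<in> E" for i j
    proof (rule ccontr)
      assume "\<not> y $ \<sigma> j < y $ \<sigma> i"
      moreover have "q $ \<sigma> j < q $ \<sigma> i" using q that by (auto simp: open_chamber_def)
      moreover have "connected ((\<lambda>z. z $ \<sigma> i - z $ \<sigma> j) ` C)"
        by (intro connected_continuous_image continuous_intros in_components_connected[OF C])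
      ultimately have "0 \<in> (\<lambda>z. z $ \<sigma> i - z $ \<sigma> j) ` C"
        using connectedD_interval[of _ "y $ \<sigma> i - y $ \<sigma> j" "q $ \<sigma> i - q $ \<sigma> j" 0] y q(2)
        by auto
      then obtain z where "z \<in> C" "z $ \<sigma> i = z $ \<sigma> j" by auto
      then show False
        using in_components_subset[OF C] that(2) by (auto simp: graphical_arrangement_def)
    qed
    then show "y \<in> ?P" by (simp add: open_chamber_def)
  qed
  ultimately have "C = ?P" by blast
  then show ?thesis using R closure_open_chamber[OF assms(3)] by simp
qed

section \<open>Blocks of a permutation\<close>

lemma block_min_le:
  assumes "bij \<sigma>" and "inv \<sigma> a \<le> inv \<sigma> b"
  shows "block_min \<sigma> a \<le> b"
proof -
  have "b = \<sigma> (inv \<sigma> b)" using assms(1) by (simp add: bij_is_surj surj_f_inv_f)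
  then show ?thesis unfolding block_min_def using assms(2) by (intro Min_le) auto
qed

lemma inv_block_min_ge:
  assumes "bij \<sigma>"
  shows "inv \<sigma> a \<le> inv \<sigma> (block_min \<sigma> a)"
proof -
  have "block_min \<sigma> a \<in> \<sigma> ` {inv \<sigma> a..}"
    unfolding block_min_def by (intro Min_in) auto
  then show ?thesis using assms by (auto simp: bij_is_inj)
qed

lemma block_min_mono:
  assumes "bij \<sigma>" and "inv \<sigma> a \<le> inv \<sigma> b"
  shows "block_min \<sigma> a \<le> block_min \<sigma> b"
  by (metis assms block_min_le inv_block_min_ge order_trans)

lemma block_min_idem:
  assumes "bij \<sigma>"
  shows "block_min \<sigma> (block_min \<sigma> a) = block_min \<sigma> a"
proof (rule antisym)
  have le: "inv \<sigma> a \<le> inv \<sigma> (block_min \<sigma> a)"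
    using inv_block_min_ge[OF assms] .
  show "block_min \<sigma> a \<le> block_min \<sigma> (block_min \<sigma> a)"
    using block_min_mono[OF assms le] .
qed (simp add: block_min_le assms)

lemma block_min_eq_self_iff:
  assumes "bij \<sigma>"
  shows "block_min \<sigma> (\<sigma> i) = \<sigma> i \<longleftrightarrow> (\<forall>j. i < j \<longrightarrow> \<sigma> i < \<sigma> j)"
proof
  assume *: "block_min \<sigma> (\<sigma> i) = \<sigma> i"
  show "\<forall>j. i < j \<longrightarrow> \<sigma> i < \<sigma> j"
  proof (intro allI impI)
    fix j assume "i < j"
    then have "\<sigma> i \<le> \<sigma> j" "\<sigma> i \<noteq> \<sigma> j"
      using block_min_le[OF assms, of "\<sigma> i" "\<sigma> j"] * assms
      by (auto simp: bij_is_inj inj_eq)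
    then show "\<sigma> i < \<sigma> j" by simp
  qed
next
  assume "\<forall>j. i < j \<longrightarrow> \<sigma> i < \<sigma> j"
  then show "block_min \<sigma> (\<sigma> i) = \<sigma> i"
    unfolding block_min_def using assms
    by (intro Min_eqI) (auto simp: bij_is_inj le_less)
qed

text \<open>By idempotence the range is the set of fixed entries, and these are the right-to-left
  minima.\<close>

lemma card_range_block_min:
  fixes \<sigma> :: "'n::{finite,linorder} \<Rightarrow> 'n"
  assumes "bij \<sigma>"
  shows "card (range (block_min \<sigma>)) = RLmin \<sigma>"
proof -
  have "range (block_min \<sigma>) = {a. block_min \<sigma> a = a}"
    using block_min_idem[OF assms] by (auto intro: sym)
  also have "\<dots> = \<sigma> ` {i. block_min \<sigma> (\<sigma> i) = \<sigma> i}"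
    using assms by (auto simp: image_iff) (metis bij_pointE)
  finally have "card (range (block_min \<sigma>)) = card {i. block_min \<sigma> (\<sigma> i) = \<sigma> i}"
    using card_image[OF inj_on_subset[OF bij_is_inj[OF assms] subset_UNIV]] by simp
  then show ?thesis
    by (simp add: block_min_eq_self_iff[OF assms] RLmin_def)
qed

text \<open>Exchanging neighbouring entries that form no edge keeps the relative order of the ends
  of every edge, so the new permutation belongs to the same region; at a descent it would be
  lexicographically smaller.\<close>

lemma nonedge_ascent_of_lex_min:
  assumes "bij \<sigma>" and "is_lex_min \<sigma> (region_perms (closed_chamber E \<sigma>))"
    and "i < j" and "{i<..<j} = {}" and "{\<sigma> i, \<sigma> j} \<notin> E"
  shows "\<sigma> i < \<sigma> j"
proof (rule ccontr)
  assume "\<not> \<sigma> i < \<sigma> j"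
  moreover have "\<sigma> i \<noteq> \<sigma> j"
    using assms(1,3) by (auto simp: bij_is_inj inj_eq)
  ultimately have gt: "\<sigma> j < \<sigma> i" by simp
  define \<tau> where "\<tau> = \<sigma> \<circ> Transposition.transpose i j"
  have "bij \<tau>" unfolding \<tau>_def using assms(1) by (simp add: bij_comp)
  moreover have "perm_cone \<tau> \<subseteq> closed_chamber E \<sigma>"
  proof
    fix y assume y: "y \<in> perm_cone \<tau>"
    have "y $ \<sigma> l \<le> y $ \<sigma> k" if "k < l" "{\<sigma> k, \<sigma> l} \<in> E" for k l
    proof -
      \<comment> \<open>The exchange reverses only the pair of positions \<open>i\<close>,
        \<open>j\<close>, which is excluded because it is a non-edge.\<close>
      have "\<not> (i < k \<and> k < j)" "\<not> (i < l \<and> l < j)" "\<not> (k = i \<and> l = j)"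
        using assms(4,5) that by auto
      then have "(k = i \<or> k = j) \<and> j < l \<or> (l = i \<or> l = j) \<and> k < i \<or>
          k \<noteq> i \<and> k \<noteq> j \<and> l \<noteq> i \<and> l \<noteq> j"
        using that(1) assms(3) by force
      then have "Transposition.transpose i j k \<le> Transposition.transpose i j l"
        using that(1) assms(3) by (elim disjE conjE) simp_all
      then have "y $ \<tau> (Transposition.transpose i j l) \<le> y $ \<tau> (Transposition.transpose i j k)"
        using y by (auto simp: perm_cone_def)
      then show ?thesis by (simp add: \<tau>_def)
    qed
    then show "y \<in> closed_chamber E \<sigma>" by (simp add: closed_chamber_def)
  qed
  ultimately have "\<tau> = \<sigma> \<or> less_fun \<sigma> \<tau>"
    using assms(2) by (auto simp: is_lex_min_def region_perms_def)
  moreover have \<tau>i: "\<tau> i = \<sigma> j" by (simp add: \<tau>_def)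
  ultimately have "less_fun \<sigma> \<tau>" using gt by auto
  then obtain k where k: "\<sigma> k < \<tau> k" "\<And>k'. k' < k \<Longrightarrow> \<sigma> k' = \<tau> k'"
    by (auto simp: less_fun_def)
  \<comment> \<open>The first difference would have to be at \<open>i\<close>, where
    \<open>\<tau>\<close> is smaller, or at \<open>j\<close>, although the two already differ at
    \<open>i\<close>.\<close>
  have "\<tau> k = \<sigma> k" if "k \<noteq> i" "k \<noteq> j" using that by (simp add: \<tau>_def)
  then have "k = i \<or> k = j" using k(1) by force
  then show False using k \<tau>i gt assms(3) by force
qed

text \<open>The path starts above \<open>a\<close> and ends below it, so some step jumps over
  \<open>a\<close>. The interval property joins \<open>a\<close> to the lower end of that step, and
  from there the old path is followed.\<close>

lemma path_crossing:
  assumes "natural_unit_interval_graph E"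
    and "(c, m) \<in> {(a, b). {a, b} \<in> E \<and> p a < p b}\<^sup>*" (is "_ \<in> ?D\<^sup>*")
    and "p a < (p c :: 'b::order)" and "m < a" and "a < c"
  shows "(a, m) \<in> ?D\<^sup>*"
  using assms(2,3,5)
proof (induction rule: converse_rtrancl_induct)
  case base
  then show ?case using assms(4) by simp
next
  case (step c c')
  have E: "{c', c} \<in> E" and "p c < p c'"
    using step.hyps(1) by (simp_all add: insert_commute)
  then have lt: "p a < p c'" using step.prems(1) by (metis order.strict_trans)
  show ?case
  proof (cases "a < c'")
    case True
    then show ?thesis using step.IH lt by blast
  next
    \<comment> \<open>Landing on \<open>a\<close> is impossible: \<open>p\<close> increases along
      the path and starts beyond \<open>p a\<close>.\<close>
    case False
    moreover have "c' \<noteq> a" using lt by auto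
    ultimately have "c' < a" by simp
    then have "{c', a} \<in> E"
      using assms(1) E \<open>a < c\<close> unfolding natural_unit_interval_graph_def
      by (meson order.strict_trans)
    then have "(a, c') \<in> ?D" using lt by (simp add: insert_commute)
    then show ?thesis using step.hyps by (meson converse_rtrancl_into_rtrancl)
  qed
qed

text \<open>Induction from the last position backwards: the path of the next entry is prolonged by
  an edge at its front, or rerouted by \<open>path_crossing\<close> if the two neighbours form a
  non-edge.\<close>

lemma path_to_block_min:
  assumes "natural_unit_interval_graph E" and "bij \<sigma>"
    and "is_lex_min \<sigma> (region_perms (closed_chamber E \<sigma>))"
  shows "(\<sigma> i, block_min \<sigma> (\<sigma> i)) \<in> {(a, b). {a, b} \<in> E \<and> inv \<sigma> a < inv \<sigma> b}\<^sup>*"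
    (is "_ \<in> ?D\<^sup>*")
proof (induction "card {i<..}" arbitrary: i rule: less_induct)
  case less
  have inv [simp]: "inv \<sigma> (\<sigma> k) = k" for k using assms(2) by (simp add: bij_is_inj)
  show ?case
  proof (cases "block_min \<sigma> (\<sigma> i) = \<sigma> i")
    case True
    then show ?thesis by simp
  next
    case False
    then have ne: "{i<..} \<noteq> {}" using block_min_eq_self_iff[OF assms(2)] by auto
    define j where "j = Min {i<..}"
    have j: "i < j" and j_le: "\<And>k. i < k \<Longrightarrow> j \<le> k"
      using ne Min_in[of "{i<..}"] by (auto simp: j_def)
    have "{i<..<j} = {}" using j_le by force
    have split: "{i..} = insert i {j..}" using j j_le by (auto simp: le_less)
    \<comment> \<open>As \<open>\<sigma> i\<close> is not its own block minimum, it is not the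
      smaller argument, and the next entry lies in the same block.\<close>
    have "block_min \<sigma> (\<sigma> i) = min (\<sigma> i) (block_min \<sigma> (\<sigma> j))"
      unfolding block_min_def inv split image_insert by (intro Min_insert) auto
    then have eq: "block_min \<sigma> (\<sigma> i) = block_min \<sigma> (\<sigma> j)"
      and less_i: "block_min \<sigma> (\<sigma> i) < \<sigma> i"
      using False by (auto simp: min_def split: if_splits)
    have "card {j<..} < card {i<..}"
      using j by (intro psubset_card_mono) auto
    then have IH: "(\<sigma> j, block_min \<sigma> (\<sigma> i)) \<in> ?D\<^sup>*" using less eq by simp
    show ?thesis
    proof (cases "{\<sigma> i, \<sigma> j} \<in> E")
      case True
      then have "(\<sigma> i, \<sigma> j) \<in> ?D" using j by simp
      then show ?thesis using IH by (rule converse_rtrancl_into_rtrancl)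
    next
      case False
      then have "\<sigma> i < \<sigma> j"
        using nonedge_ascent_of_lex_min[OF assms(2,3) j \<open>{i<..<j} = {}\<close>] by simp
      then show ?thesis
        using j less_i by (intro path_crossing[OF assms(1) IH]) simp_all
    qed
  qed
qed

text \<open>Every step of the path is an edge traversed from an earlier to a later position, along
  which coordinates of a chamber point cannot increase.\<close>

lemma closed_chamber_block_min_le:
  assumes "natural_unit_interval_graph E" and "bij \<sigma>"
    and "is_lex_min \<sigma> (region_perms (closed_chamber E \<sigma>))"
    and "y \<in> closed_chamber E \<sigma>"
  shows "y $ block_min \<sigma> a \<le> y $ a"
proof -
  have surj: "\<sigma> (inv \<sigma> b) = b" for b using assms(2) by (simp add: bij_is_surj surj_f_inv_f)
  have le: "y $ \<sigma> j \<le> y $ \<sigma> i" if "i < j" "{\<sigma> i, \<sigma> j} \<in> E" for i j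
    using assms(4) that by (simp add: closed_chamber_def)
  have "(a, block_min \<sigma> a) \<in> {(a, b). {a, b} \<in> E \<and> inv \<sigma> a < inv \<sigma> b}\<^sup>*"
    using path_to_block_min[OF assms(1-3), of "inv \<sigma> a"] by (simp add: surj)
  then show ?thesis
  proof (induction rule: rtrancl_induct)
    case (step b c)
    then have "{b, c} \<in> E" "inv \<sigma> b < inv \<sigma> c" by simp_all
    then have "y $ c \<le> y $ b"
      using le[of "inv \<sigma> b" "inv \<sigma> c"] by (simp add: surj)
    then show ?case using step.IH by simp
  qed simp
qed

section \<open>Vectors that are constant on fibres\<close>

lemma subspace_fiber_constant: "subspace {y :: real^'n::finite. \<forall>a. y $ f a = y $ a}"
  by (auto simp: subspace_def)

text \<open>Idempotence makes \<open>range f\<close> a system of representatives of the fibres.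
  Spreading their values over the fibres is a linear isomorphism from the vectors supported on
  \<open>range f\<close>.\<close>

lemma dim_fiber_constant:
  fixes f :: "'n::finite \<Rightarrow> 'n"
  assumes "\<And>a. f (f a) = f a"
  shows "dim {y :: real^'n. \<forall>a. y $ f a = y $ a} = card (range f)"
proof -
  let ?S = "{y :: real^'n. \<forall>i. i \<notin> range f \<longrightarrow> y $ i = 0}"
  let ?g = "\<lambda>y :: real^'n. (\<chi> a. y $ f a) :: real^'n"
  have lin: "linear ?g"
    by (intro linearI) (simp_all add: vec_eq_iff)
  have sub: "subspace ?S" by (simp add: subspace_def)
  have inj: "inj_on ?g ?S"
  proof (intro inj_onI)
    fix x y assume x: "x \<in> ?S" and y: "y \<in> ?S" and "?g x = ?g y"
    then have "x $ f a = y $ f a" for a by (simp add: vec_eq_iff)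
    then have "x $ a = y $ a" for a
      using x y by (cases "a \<in> range f") (blast, simp)
    then show "x = y" by (simp add: vec_eq_iff)
  qed
  have "?g ` ?S = {y. \<forall>a. y $ f a = y $ a}"
  proof (intro equalityI subsetI)
    fix y :: "real^'n" assume y: "y \<in> {y. \<forall>a. y $ f a = y $ a}"
    have "y = ?g (\<chi> a. if a \<in> range f then y $ a else 0)"
      using y by (simp add: vec_eq_iff)
    then show "y \<in> ?g ` ?S" by (rule image_eqI) simp
  qed (auto simp: assms)
  then have "dim {y :: real^'n. \<forall>a. y $ f a = y $ a} = dim (?g ` ?S)" by simp
  also have "\<dots> = dim ?S"
    using inj sub by (intro dim_image_eq[OF lin]) (simp add: span_eq_iff[THEN iffD2])
  also have "\<dots> = card (range f)" by (simp add: dim_substandard_cart flip: dim_vec_eq)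
  finally show ?thesis .
qed

lemma fiber_average_cong: "f a = f b \<Longrightarrow> fiber_average f v $ a = fiber_average f v $ b"
  by (simp add: fiber_average_def)

text \<open>On each fibre \<open>w\<close> is constant, while the deviations of \<open>v\<close>
  from its average sum to zero.\<close>

lemma fiber_average_orthogonal:
  fixes f :: "'n::finite \<Rightarrow> 'b"
  assumes "\<And>a b. f a = f b \<Longrightarrow> w $ a = w $ b"
  shows "(v - fiber_average f v) \<bullet> w = 0"
proof -
  let ?x = "fiber_average f v"
  have "(\<Sum>a | f a = c. (v - ?x) $ a * w $ a) = 0" if "c \<in> range f" for c
  proof -
    from that obtain d where d: "c = f d" by blast
    have card: "card {a. f a = f d} \<noteq> 0" by auto
    have "(\<Sum>a | f a = c. (v - ?x) $ a * w $ a) = (\<Sum>a | f a = c. (v $ a - ?x $ d) * w $ d)"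
    proof (rule sum.cong)
      fix a assume "a \<in> {a. f a = c}"
      then have "f a = f d" using d by simp
      then have "?x $ a = ?x $ d" "w $ a = w $ d"
        by (rule fiber_average_cong, rule assms)
      then show "(v - ?x) $ a * w $ a = (v $ a - ?x $ d) * w $ d" by simp
    qed simp
    also have "\<dots> = ((\<Sum>a | f a = c. v $ a) - card {a. f a = c} * ?x $ d) * w $ d"
      unfolding sum_distrib_right[symmetric] by (simp add: sum_subtractf)
    also have "\<dots> = 0" using card d by (simp add: fiber_average_def)
    finally show ?thesis .
  qed
  then have "(\<Sum>c\<in>range f. \<Sum>a | f a = c. (v - ?x) $ a * w $ a) = 0"
    by (intro sum.neutral) auto
  then show ?thesis
    using sum.image_gen[of UNIV "\<lambda>a. (v - ?x) $ a * w $ a" f]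
    by (simp add: inner_vec_def)
qed

lemma fiber_average_ge:
  fixes f :: "'n::finite \<Rightarrow> 'b"
  assumes "\<And>a. v $ a \<ge> 0" and "f b = f a"
  shows "v $ b / CARD('n) \<le> fiber_average f v $ a"
proof -
  have "v $ b \<le> (\<Sum>c | f c = f a. v $ c)"
    using assms by (intro member_le_sum) auto
  moreover have "card {c. f c = f a} \<le> CARD('n)" by (intro card_mono) auto
  moreover have "card {c. f c = f a} > 0" by (auto simp: card_gt_0_iff)
  moreover have "(\<Sum>c | f c = f a. v $ c) \<ge> 0"
    using assms(1) by (intro sum_nonneg) auto
  ultimately show ?thesis
    unfolding fiber_average_def by (simp add: frac_le)
qed

lemma fiber_average_le:
  assumes "\<And>b. f b = f a \<Longrightarrow> v $ b \<le> K"
  shows "fiber_average f v $ a \<le> K"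
proof -
  have "card {c. f c = f a} > 0" by (auto simp: card_gt_0_iff)
  moreover have "(\<Sum>c | f c = f a. v $ c) \<le> of_nat (card {c. f c = f a}) * K"
    using assms by (intro sum_bounded_above) auto
  ultimately show ?thesis
    unfolding fiber_average_def by (simp add: divide_le_eq mult.commute)
qed

section \<open>Weights that decrease fast\<close>

text \<open>Extends the gap from neighbours to all pairs, by induction from the largest index down.
  Positivity and \<open>K \<ge> 1\<close> make the weights decrease, so the factor \<open>K\<close>
  gained further on is not lost.\<close>

lemma fast_decreasing:
  fixes v :: "real^'n::{finite,linorder}"
  assumes step: "\<And>i j. i < j \<Longrightarrow> {i<..<j} = {} \<Longrightarrow> v $ i > K * v $ j"
    and "v $ Max UNIV > 0" and "K \<ge> 1"
  shows "v $ a > 0" and "a < b \<Longrightarrow> v $ a > K * v $ b"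
proof -
  have main: "v $ a > 0 \<and> (\<forall>b. a < b \<longrightarrow> v $ a > K * v $ b)" for a
  proof (induction "card {a<..}" arbitrary: a rule: less_induct)
    case less
    show ?case
    proof (cases "{a<..} = {}")
      case True
      then have "a = Max UNIV" by (intro Max_eqI[symmetric]) (auto simp flip: not_less)
      then show ?thesis using True assms(2) by auto
    next
      case False
      define j where "j = Min {a<..}"
      have j: "a < j" and j_le: "\<And>k. a < k \<Longrightarrow> j \<le> k"
        using False Min_in[of "{a<..}"] by (auto simp: j_def)
      have "{a<..<j} = {}" using j_le by force
      then have "v $ a > K * v $ j" using step[OF j] by simp
      have "card {j<..} < card {a<..}" using j by (intro psubset_card_mono) auto
      then have IH: "v $ j > 0" "\<And>b. j < b \<Longrightarrow> v $ j > K * v $ b" using less by auto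
      have "v $ j \<le> K * v $ j" using IH(1) assms(3) by simp
      then have "v $ a > v $ j" using \<open>v $ a > K * v $ j\<close> by simp
      moreover have "v $ a > K * v $ b" if "a < b" for b
        using j_le[OF that] IH(2)[of b] \<open>v $ a > K * v $ j\<close> \<open>v $ a > v $ j\<close>
        by (cases "b = j") (simp_all add: le_less)
      ultimately show ?thesis using IH(1) by auto
    qed
  qed
  then show "v $ a > 0" by blast
  show "a < b \<Longrightarrow> v $ a > K * v $ b" using main by blast
qed

section \<open>The projection and its face\<close>

text \<open>The obtuse angle criterion: expanding the squared distance from \<open>v\<close> to
  \<open>y\<close> around \<open>x\<close> adds only nonnegative terms.\<close>

lemma closest_point_eqI:
  fixes S :: "'a::euclidean_space set"
  assumes "convex S" "closed S" "x \<in> S" "\<And>y. y \<in> S \<Longrightarrow> (v - x) \<bullet> (y - x) \<le> 0"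
  shows "closest_point S v = x"
proof -
  have "dist v x \<le> dist v y" if "y \<in> S" for y
  proof -
    have "(v - y) \<bullet> (v - y) = (v - x) \<bullet> (v - x) - 2 * ((v - x) \<bullet> (y - x)) + (y - x) \<bullet> (y - x)"
      by (simp add: inner_diff_left inner_diff_right inner_commute)
    then have "(v - x) \<bullet> (v - x) \<le> (v - y) \<bullet> (v - y)"
      using assms(4)[OF that] inner_ge_zero[of "y - x"] by linarith
    then show ?thesis by (simp add: dist_norm norm_le)
  qed
  then show ?thesis using closest_point_unique[OF assms(1-3)] by auto
qed

text \<open>Faces whose relative interiors meet coincide, so the definite description picks
  \<open>F\<close>.\<close>

lemma proj_dim_eqI:
  assumes "F face_of R" and "closest_point R v \<in> rel_interior F"
  shows "proj_dim v R = aff_dim F"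
proof -
  have "(THE F. F face_of R \<and> closest_point R v \<in> rel_interior F) = F"
    using assms by (intro the_equality conjI) (auto dest: face_of_eq[of _ R F])
  then show ?thesis by (simp add: proj_dim_def)
qed

text \<open>The gaps \<open>y $ a - y $ f a\<close> are nonnegative on \<open>R\<close>, so they
  vanish at an inner point of a segment only if they vanish at both ends.\<close>

lemma face_of_fiber_constant:
  assumes "convex R" and le: "\<And>y a. y \<in> R \<Longrightarrow> y $ f a \<le> y $ a"
  shows "(R \<inter> {y. \<forall>a. y $ f a = y $ a}) face_of (R :: (real^'n::finite) set)"
  unfolding face_of_def
proof (intro conjI ballI impI)
  show "convex (R \<inter> {y. \<forall>a. y $ f a = y $ a})"
    using assms(1) by (intro convex_Int subspace_imp_convex[OF subspace_fiber_constant])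
next
  fix y z x
  assume y: "y \<in> R" and z: "z \<in> R" and x: "x \<in> R \<inter> {y. \<forall>a. y $ f a = y $ a}"
    and "x \<in> open_segment y z"
  then obtain u where u: "0 < u" "u < 1" "x = (1 - u) *\<^sub>R y + u *\<^sub>R z"
    by (auto simp: in_segment)
  have "y $ f a = y $ a \<and> z $ f a = z $ a" for a
  proof -
    have "(1 - u) * (y $ a - y $ f a) + u * (z $ a - z $ f a) = x $ a - x $ f a"
      by (simp add: u(3) algebra_simps)
    also have "\<dots> = 0" using x by simp
    finally have "(1 - u) * (y $ a - y $ f a) + u * (z $ a - z $ f a) = 0" .
    moreover have "(1 - u) * (y $ a - y $ f a) \<ge> 0" "u * (z $ a - z $ f a) \<ge> 0"
      using u le[OF y, of a] le[OF z, of a] by simp_all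
    ultimately have "(1 - u) * (y $ a - y $ f a) = 0" "u * (z $ a - z $ f a) = 0" by linarith+
    then show ?thesis using u by simp
  qed
  then show "y \<in> R \<inter> {y. \<forall>a. y $ f a = y $ a}" "z \<in> R \<inter> {y. \<forall>a. y $ f a = y $ a}"
    using y z by auto
qed auto

lemma open_strict_antimono:
  fixes g :: "'n::finite \<Rightarrow> 'b::order"
  shows "open {y :: real^'n. \<forall>a b. g a < g b \<longrightarrow> y $ b < y $ a}"
proof -
  have "{y :: real^'n. \<forall>a b. g a < g b \<longrightarrow> y $ b < y $ a} =
      (\<Inter>(a, b)\<in>{(a, b). g a < g b}. {y. y $ b < y $ a})" by auto
  then show ?thesis
    by (simp add: open_INT open_Collect_less continuous_on_component split_def)
qed

theorem theorem5p2:
  fixes E :: "'n::{finite,linorder} set set"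
    and R :: "(real^'n::{finite,linorder}) set"
    and \<sigma> :: "'n \<Rightarrow> 'n"
    and v :: "real^'n::{finite,linorder}"
  assumes "natural_unit_interval_graph E"
    and "R \<in> regions (graphical_arrangement E)"
    and "is_lex_min \<sigma> (region_perms R)"
    and "\<And>i j. i < j \<Longrightarrow> {i<..<j} = {} \<Longrightarrow>
           v $ i > (6 * real CARD('n) ^ 2 + 1) * v $ j"
    and "v $ Max UNIV > 0"
  shows "proj_dim v R = int (RLmin \<sigma>)"
proof -
  have bij: "bij \<sigma>" and cone: "perm_cone \<sigma> \<subseteq> R"
    using assms(3) by (auto simp: is_lex_min_def region_perms_def)
  have R: "R = closed_chamber E \<sigma>"
    using region_eq_closed_chamber[OF _ assms(2) bij cone] assms(1)
    by (simp add: natural_unit_interval_graph_def)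
  define m where "m = block_min \<sigma>"
  define W where "W = {y :: real^'n::{finite,linorder}. \<forall>a. y $ m a = y $ a}"
  define x where "x = fiber_average m v"
  \<comment> \<open>\<open>U\<close> is an open neighbourhood of the projection \<open>x\<close>,
    and below \<open>U \<inter> W\<close> is shown to lie in \<open>R\<close>. This gives both the
    affine hull and the relative interior of the face \<open>R \<inter> W\<close>.\<close>
  define U where "U = {y :: real^'n::{finite,linorder}. \<forall>a b. m a < m b \<longrightarrow> y $ b < y $ a}"
  have m_idem: "m (m a) = m a" for a
    unfolding m_def by (rule block_min_idem[OF bij])
  have m_le: "m a \<le> a" for a
    unfolding m_def by (rule block_min_le[OF bij order_refl])
  have R_le: "y $ m a \<le> y $ a" if "y \<in> R" for y a
    unfolding m_def using closed_chamber_block_min_le[OF assms(1) bij] assms(3) that R by blast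
  have W_iff: "y \<in> W \<longleftrightarrow> (\<forall>a b. m a = m b \<longrightarrow> y $ a = y $ b)" for y
  proof
    assume "y \<in> W"
    then have "y $ a = y $ m a" for a by (simp add: W_def)
    then show "\<forall>a b. m a = m b \<longrightarrow> y $ a = y $ b" by metis
  next
    assume "\<forall>a b. m a = m b \<longrightarrow> y $ a = y $ b"
    then have "y $ m a = y $ a" for a using m_idem by blast
    then show "y \<in> W" by (simp add: W_def)
  qed

  let ?K = "6 * real CARD('n) ^ 2 + 1"
  have "real CARD('n) \<le> real CARD('n) ^ 2"
    by (simp add: power2_eq_square)
  then have K: "real CARD('n) \<le> ?K" "1 \<le> ?K" by linarith+
  have pos: "v $ a > 0" for a
    by (rule fast_decreasing(1)[OF _ assms(5) K(2)]) (rule assms(4))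
  have fast': "v $ a > ?K * v $ b" if "a < b" for a b
    by (rule fast_decreasing(2)[OF _ assms(5) K(2) that]) (rule assms(4))
  \<comment> \<open>Even after division by \<open>CARD('n)\<close>, the largest loss from averaging
    over a block, the earlier weight still wins.\<close>
  have fast: "v $ b < v $ a / CARD('n)" if "a < b" for a b
  proof -
    have "CARD('n) * v $ b \<le> ?K * v $ b"
      using K(1) pos[of b] by (intro mult_right_mono) auto
    also have "\<dots> < v $ a" using fast'[OF that] .
    finally show ?thesis by (simp add: less_divide_eq mult.commute)
  qed
  have x_ge: "v $ m a / CARD('n) \<le> x $ a" for a
    unfolding x_def using pos m_idem by (intro fiber_average_ge) (auto intro: less_imp_le)
  have v_le: "v $ a \<le> v $ m a" for a
  proof (cases "m a = a")
    case False
    then have "v $ a < v $ m a / CARD('n)" using fast m_le[of a] by simp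
    also have "\<dots> \<le> v $ m a" using pos[of "m a"] by (simp add: divide_le_eq)
    finally show ?thesis by simp
  qed simp
  have x_le: "x $ a \<le> v $ m a" for a
    unfolding x_def by (intro fiber_average_le) (metis v_le)
  \<comment> \<open>For \<open>m a < m b\<close> the chain is
    \<open>x $ b \<le> v $ m b < v $ m a / CARD('n) \<le> x $ a\<close>.\<close>
  have "x \<in> U"
    unfolding U_def by (auto intro: order.strict_trans2[OF order.strict_trans1[OF x_le fast] x_ge])
  have "x \<in> W"
    unfolding W_iff x_def by (auto intro: fiber_average_cong)
  \<comment> \<open>Block minima increase weakly along \<open>\<sigma>\<close>, so a vector that is
    constant on blocks and decreases between them is sorted by \<open>\<sigma>\<close>.\<close>
  have "U \<inter> W \<subseteq> perm_cone \<sigma>"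
  proof
    fix y assume y: "y \<in> U \<inter> W"
    have "y $ \<sigma> j \<le> y $ \<sigma> i" if "i \<le> j" for i j
    proof -
      have "m (\<sigma> i) \<le> m (\<sigma> j)"
        unfolding m_def using that bij by (intro block_min_mono) (simp_all add: bij_is_inj)
      then consider "m (\<sigma> i) < m (\<sigma> j)" | "m (\<sigma> i) = m (\<sigma> j)" by fastforce
      then show ?thesis
      proof cases
        case 1
        then show ?thesis using y unfolding U_def by (simp add: less_imp_le)
      next
        case 2
        then have "y $ \<sigma> i = y $ \<sigma> j" using y W_iff by blast
        then show ?thesis by simp
      qed
    qed
    then show "y \<in> perm_cone \<sigma>" by (simp add: perm_cone_def)
  qed
  then have UW: "U \<inter> W \<subseteq> R" using cone by blast

  have "closest_point R v = x"
  proof (rule closest_point_eqI)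
    show "convex R" "closed R" "x \<in> R"
      using R convex_closed_chamber closed_closed_chamber UW \<open>x \<in> U\<close> \<open>x \<in> W\<close> by auto
    fix y assume y: "y \<in> R"
    \<comment> \<open>Split \<open>y - x\<close> into \<open>?w - x\<close>, which is constant on
      blocks and hence orthogonal to \<open>v - x\<close>, and \<open>y - ?w\<close>, which is
      nonnegative and vanishes at block minima.\<close>
    let ?w = "(\<chi> a. y $ m a) :: real^'n::{finite,linorder}"
    have "?w - x \<in> W"
      using \<open>x \<in> W\<close> unfolding W_iff vector_minus_component vec_lambda_beta by metis
    then have "(v - x) \<bullet> (?w - x) = 0"
      unfolding x_def W_iff by (intro fiber_average_orthogonal) blast
    then have "(v - x) \<bullet> (y - x) = (v - x) \<bullet> (y - ?w)"
      by (simp add: inner_diff_right)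
    also have "\<dots> = (\<Sum>a\<in>UNIV. (v $ a - x $ a) * (y $ a - y $ m a))"
      by (simp add: inner_vec_def)
    also have "\<dots> \<le> 0"
    proof (intro sum_nonpos)
      fix a
      show "(v $ a - x $ a) * (y $ a - y $ m a) \<le> 0"
      proof (cases "m a = a")
        case False
        then have "m a < a" using m_le[of a] by simp
        \<comment> \<open>Off the block minima \<open>v\<close> lies below the block average, so the
          first factor is negative.\<close>
        then have "v $ a < x $ a" using fast x_ge[of a] by fastforce
        then show ?thesis using R_le[OF y, of a] by (intro mult_nonpos_nonneg) simp_all
      qed simp
    qed
    finally show "(v - x) \<bullet> (y - x) \<le> 0" .
  qed
  moreover have "open U" unfolding U_def by (rule open_strict_antimono)
  have sub: "subspace W" unfolding W_def by (rule subspace_fiber_constant)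
  have hull: "affine hull (R \<inter> W) = W"
  proof
    show "affine hull (R \<inter> W) \<subseteq> W"
      using subspace_imp_affine[OF sub] by (intro hull_minimal) auto
    \<comment> \<open>A nonempty relatively open part of the subspace \<open>W\<close> already spans
      it.\<close>
    have "affine hull (W \<inter> U) = affine hull W"
      using \<open>open U\<close> \<open>x \<in> U\<close> \<open>x \<in> W\<close> sub
      by (intro affine_hull_convex_Int_open subspace_imp_convex) auto
    then show "W \<subseteq> affine hull (R \<inter> W)"
      using UW hull_subset[of W affine] hull_mono[of "W \<inter> U" "R \<inter> W" affine] by blast
  qed
  have "x \<in> rel_interior (R \<inter> W)"
    unfolding mem_rel_interior hull
    using \<open>open U\<close> \<open>x \<in> U\<close> \<open>x \<in> W\<close> UW by blast
  moreover have "(R \<inter> W) face_of R"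
    unfolding W_def using R_le R convex_closed_chamber by (intro face_of_fiber_constant) auto
  ultimately have "proj_dim v R = aff_dim (R \<inter> W)"
    by (intro proj_dim_eqI) auto
  also have "\<dots> = int (dim W)"
    using hull sub by (metis aff_dim_affine_hull aff_dim_subspace)
  also have "\<dots> = int (card (range m))"
    unfolding W_def using dim_fiber_constant[OF m_idem] by simp
  also have "\<dots> = int (RLmin \<sigma>)"
    unfolding m_def using card_range_block_min[OF bij] by simp
  finally show ?thesis .
qed

end
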